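(* Let $V\in C^{1}(\mathbb{R}^{N}\setminus\{0\},\mathbb{R})$ satisfy: (1) $V(-x)=V(x)$ for all $x\in\mathbb{R}^{N}\setminus\{0\}$; (2) there is a constant $\alpha\in(0,2)$ such that $(x,\nabla V(x))=-\alpha V(x)<0$ for every $x\in\mathbb{R}^{N}\setminus\{0\}$; (3) there exist constants $\beta>1$, $M_{0}>0$ and $r_{0}\geq 1$ such that $|x|^{\beta+1}|\nabla V(x)|\leq M_{0}$ for all $|x|\geq r_{0}$. Then for every $H>0$ and every given direction $e\in S^{N-1}=\{x\in\mathbb{R}^{N}: |x|=1\}$ there is at least one hyperbolic orbit $u$ of the system $$\ddot u(t)+\nabla V(u(t))=0,\qquad \tfrac12|\dot u(t)|^{2}+V(u(t))=H$$ which has the given asymptotic direction $e$ at infinity, i.e. $$\frac{u(t)}{|u(t)|}\to e \quad\text{as } t\to+\infty \qquad\text{and}\qquad \frac{u(t)}{|u(t)|}\to e\quad\text{as } t\to-\infty .$$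
   Context: $(\cdot,\cdot)$ denotes the standard Euclidean inner product on $\mathbb{R}^{N}$, $|\cdot|$ the induced norm, and $\nabla V$ the gradient of $V$. A hyperbolic orbit of the system is a function $u:\mathbb{R}\to\mathbb{R}^{N}\setminus\{0\}$ satisfying both equations of the system for all $t\in\mathbb{R}$ and such that $|u(t)|\to\infty$ as $t\to+\infty$ and as $t\to-\infty$. *)

theory Defs
  imports "HOL-Analysis.Analysis"
begin

definition grad :: "('a::real_inner \<Rightarrow> real) \<Rightarrow> 'a \<Rightarrow> 'a" where
  "grad f x = (THE g. GDERIV f x :> g)"

text \<open>Continuous differentiability on \<^term>\<open>S\<close>, meant for open \<^term>\<open>S\<close>; the values of the
  function outside \<^term>\<open>S\<close> play no role then.\<close>

definition C1_on :: "'a::euclidean_space set \<Rightarrow> ('a \<Rightarrow> real) \<Rightarrow> bool" where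
  "C1_on S f \<longleftrightarrow> (\<forall>x\<in>S. f differentiable (at x)) \<and> continuous_on S (grad f)"

definition solves_system ::
    "('a::euclidean_space \<Rightarrow> real) \<Rightarrow> real \<Rightarrow> (real \<Rightarrow> 'a) \<Rightarrow> bool" where
  "solves_system V H u \<longleftrightarrow>
     (\<exists>v a. \<forall>t.
        (u has_vector_derivative v t) (at t) \<and>
        (v has_vector_derivative a t) (at t) \<and>
        a t + grad V (u t) = 0 \<and>
        1 / 2 * (norm (v t))\<^sup>2 + V (u t) = H)"

definition hyperbolic_orbit ::
    "('a::euclidean_space \<Rightarrow> real) \<Rightarrow> real \<Rightarrow> (real \<Rightarrow> 'a) \<Rightarrow> bool" where
  "hyperbolic_orbit V H u \<longleftrightarrow>
     (\<forall>t. u t \<noteq> 0) \<and>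
     solves_system V H u \<and>
     filterlim (\<lambda>t. norm (u t)) at_top at_top \<and>
     filterlim (\<lambda>t. norm (u t)) at_top at_bot"

lemma grad_eqI:
  assumes "GDERIV f x :> g"
  shows "grad f x = g"
  unfolding grad_def
proof (rule the_equality)
  show "GDERIV f x :> g" by (rule assms)
next
  fix g' assume "GDERIV f x :> g'"
  with assms have "(\<lambda>h. h \<bullet> g') = (\<lambda>h. h \<bullet> g)"
    unfolding gderiv_def by (metis has_derivative_unique)
  then have "(g' - g) \<bullet> (g' - g) = 0"
    by (metis inner_diff_right right_minus_eq)
  then show "g' = g" by simp
qed

lemma GDERIV_grad:
  fixes f :: "'a::euclidean_space \<Rightarrow> real"
  assumes "f differentiable (at x)"
  shows "GDERIV f x :> grad f x"
proof -
  obtain D where D: "(f has_derivative D) (at x)"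
    using assms by (auto simp: differentiable_def)
  then have lin: "linear D" by (rule has_derivative_linear)
  have "D h = h \<bullet> (\<Sum>b\<in>Basis. D b *\<^sub>R b)" for h
  proof -
    have "D h = D (\<Sum>b\<in>Basis. (h \<bullet> b) *\<^sub>R b)" by (simp add: euclidean_representation)
    also have "\<dots> = (\<Sum>b\<in>Basis. (h \<bullet> b) * D b)"
      using lin by (simp add: linear_sum linear_cmul)
    finally show ?thesis by (simp add: inner_sum_right mult.commute)
  qed
  then have "D = (\<lambda>h. h \<bullet> (\<Sum>b\<in>Basis. D b *\<^sub>R b))" by blast
  with D have "GDERIV f x :> (\<Sum>b\<in>Basis. D b *\<^sub>R b)"
    unfolding gderiv_def by simp
  then show ?thesis using grad_eqI by metis
qed

end

theory Submission
  imports Defs "HOL-Complex_Analysis.Great_Picard"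
begin

text \<open>
  The force \<open>F = - \<nabla>V\<close> is repulsive, so the orbit is sought as a brake orbit: a solution that starts at
  rest on the level set \<open>V = H\<close> (star-shaped by Euler homogeneity) and is continued evenly to negative
  times. The starting point has to be chosen so that the limit velocity points in the direction \<open>e\<close>.

  As \<open>F\<close> is merely continuous, there is no flow map. The symplectic Euler scheme replaces it: repulsion
  makes \<open>\<bar>u\<bar>\<close> convex along the scheme, which gives linear growth of \<open>\<bar>u\<bar>\<close> and summable velocity
  increments, uniformly in the step size. Moreover \<open>u\<^sub>k \<bullet> u\<^sub>k\<^sub>+\<^sub>1 > 0\<close> and \<open>u\<^sub>k \<bullet> v\<^sub>k\<^sub>+\<^sub>1 > 0\<close>, so the map sending
  the initial direction to the velocity at any later step is homotopic in \<open>\<real>\<^sup>N - {0}\<close> to the inclusion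
  of the sphere, and therefore meets the ray through \<open>e\<close>. A subsequence of the schemes with final
  velocity on this ray converges, as the step tends to 0 and the final time to infinity, to the orbit.
\<close>

subsection \<open>Maps of the sphere and the geometry of the norm\<close>

text \<open>If \<open>g\<close> missed the open ray through \<open>e\<close>, the segments from
  \<open>g x\<close> to \<open>- e\<close> would avoid 0 and make the inclusion of the sphere
  homotopic to a constant in the punctured space. Composing with \<open>sgn\<close> would then
  contract the sphere. Dimension 1 is covered as well: there the sphere consists of two
  points.\<close>

lemma homotopic_inclusion_meets_ray:
  fixes g :: "'a::euclidean_space \<Rightarrow> 'a"
  assumes hom: "homotopic_with_canon (\<lambda>_. True) (sphere 0 1) (- {0}) id g"
    and e: "norm e = 1"
  obtains \<theta> r where "norm \<theta> = 1" "0 < r" "g \<theta> = r *\<^sub>R e"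
proof -
  have "\<exists>\<theta>\<in>sphere 0 1. \<exists>r>0. g \<theta> = r *\<^sub>R e"
  proof (rule ccontr)
    assume neg: "\<not> ?thesis"
    have contg: "continuous_on (sphere 0 1) g" and g0: "g \<in> sphere 0 1 \<rightarrow> - {0}"
      using homotopic_with_imp_continuous[OF hom] homotopic_with_imp_funspace2[OF hom] by auto
    have "closed_segment (g x) (- e) \<subseteq> - {0}" if "x \<in> sphere 0 1" for x
    proof
      fix y assume "y \<in> closed_segment (g x) (- e)"
      then obtain t where t: "0 \<le> t" "t \<le> 1" "y = (1 - t) *\<^sub>R g x + t *\<^sub>R (- e)"
        by (auto simp: in_segment)
      have "y \<noteq> 0"
      proof
        assume "y = 0"
        then have eq: "(1 - t) *\<^sub>R g x = t *\<^sub>R e" using t by simp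
        have "t < 1" using eq t e by (cases "t = 1") auto
        then have "g x = (t / (1 - t)) *\<^sub>R e"
          using arg_cong[OF eq, of "\<lambda>z. (1 / (1 - t)) *\<^sub>R z"] by simp
        moreover have "t \<noteq> 0" using eq g0 that by auto
        ultimately show False using neg that t \<open>t < 1\<close>
          by (metis divide_pos_pos diff_gt_0_iff_gt order_le_less)
      qed
      then show "y \<in> - {0}" by simp
    qed
    then have "homotopic_with_canon (\<lambda>_. True) (sphere 0 1) (- {0}) g (\<lambda>_. - e)"
      by (intro homotopic_with_linear contg continuous_intros)
    with hom have h: "homotopic_with_canon (\<lambda>_. True) (sphere 0 1) (- {0}) id (\<lambda>_. - e)"
      by (rule homotopic_with_trans)
    have "continuous_map (top_of_set (- {0::'a})) (top_of_set (sphere 0 1)) sgn"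
      by (auto intro!: continuous_intros simp: norm_sgn)
    then have "homotopic_with_canon (\<lambda>_. True) (sphere 0 1) (sphere 0 1) (sgn \<circ> id) (sgn \<circ> (\<lambda>_. - e))"
      by (intro homotopic_with_compose_continuous_map_left[OF h]) auto
    then have "homotopic_with_canon (\<lambda>_. True) (sphere (0::'a) 1) (sphere 0 1) id (\<lambda>_. sgn (- e))"
      by (rule homotopic_with_eq) (auto simp: sgn_div_norm)
    then have "contractible (sphere (0::'a) 1)" by (auto simp: contractible_def)
    then show False by (simp add: contractible_sphere)
  qed
  then show ?thesis using that by auto
qed

text \<open>Every point of the segment has positive inner product with \<open>a\<close>. All
  straight-line homotopies in \<open>shooting\<close> rest on this.\<close>

lemma zero_notin_closed_segment:
  fixes a b :: "'a::real_inner"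
  assumes "0 < a \<bullet> b"
  shows "closed_segment a b \<subseteq> - {0}"
proof
  fix y assume "y \<in> closed_segment a b"
  then obtain t where t: "0 \<le> t" "t \<le> 1" "y = (1 - t) *\<^sub>R a + t *\<^sub>R b"
    by (auto simp: in_segment)
  have "a \<noteq> 0" using assms by auto
  have "0 < (1 - t) * (a \<bullet> a) + t * (a \<bullet> b)"
  proof (cases "t = 0")
    case False
    then have "0 < t * (a \<bullet> b)" using assms t by simp
    then show ?thesis using t by (intro add_nonneg_pos mult_nonneg_nonneg) auto
  qed (use \<open>a \<noteq> 0\<close> in simp)
  then have "a \<bullet> y \<noteq> 0" using t by (simp add: inner_add_right)
  then show "y \<in> - {0}" by auto
qed

lemma inner_sgn_self: "x \<bullet> sgn x = norm x" for x :: "'a::real_inner"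
  by (cases "x = 0") (simp_all add: sgn_div_norm dot_square_norm power2_eq_square)

lemma norm_ge_inner_sgn: "x \<bullet> sgn y \<le> norm x" for x y :: "'a::real_inner"
  using norm_cauchy_schwarz[of x "sgn y"] by (cases "y = 0") (auto simp: norm_sgn)

text \<open>\<open>sgn u\<close> is a subgradient of \<open>norm\<close> at \<open>u\<close>, also
  at \<open>u = 0\<close> where it is 0. The sign of \<open>h\<close> is free, so the step can be
  taken backwards too.\<close>

lemma norm_add_scaleR_ge:
  fixes u w :: "'a::real_inner"
  shows "norm u + h * (w \<bullet> sgn u) \<le> norm (u + h *\<^sub>R w)"
  using norm_ge_inner_sgn[of "u + h *\<^sub>R w" u] by (simp add: inner_add_left inner_sgn_self)

text \<open>This is the monotonicity of the subgradient of the convex function \<^term>\<open>norm\<close>.\<close>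

lemma inner_sgn_mono:
  fixes u w :: "'a::real_inner"
  assumes "0 < h"
  shows "w \<bullet> sgn u \<le> w \<bullet> sgn (u + h *\<^sub>R w)"
proof -
  have "norm u \<ge> norm (u + h *\<^sub>R w) - h * (w \<bullet> sgn (u + h *\<^sub>R w))"
    using norm_add_scaleR_ge[of "u + h *\<^sub>R w" "- h" w] by simp
  with norm_add_scaleR_ge[of u h w] have "h * (w \<bullet> sgn u) \<le> h * (w \<bullet> sgn (u + h *\<^sub>R w))" by linarith
  then show ?thesis using assms by simp
qed

subsection \<open>The scheme for a repulsive force\<close>

text \<open>Inverse-square decay is the form in which the condition at infinity is used: along a
  path whose norm grows linearly it makes the force integrable in time.\<close>

locale repulsive_force =
  fixes F :: "'a::euclidean_space \<Rightarrow> 'a" and M r\<^sub>0 :: real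
  assumes cont_F: "continuous_on (- {0}) F"
    and repulsive: "x \<noteq> 0 \<Longrightarrow> 0 < F x \<bullet> x"
    and decay: "norm x \<ge> r\<^sub>0 \<Longrightarrow> norm (F x) * (norm x)\<^sup>2 \<le> M"
begin

text \<open>Symplectic Euler scheme (kick, then drift) for particles starting at rest, with time step \<open>h\<close>.\<close>

primrec scheme :: "real \<Rightarrow> 'a \<Rightarrow> nat \<Rightarrow> 'a \<times> 'a" where
  "scheme h x 0 = (x, 0)"
| "scheme h x (Suc k) =
    (let v = snd (scheme h x k) + h *\<^sub>R F (fst (scheme h x k)) in (fst (scheme h x k) + h *\<^sub>R v, v))"

definition pos :: "real \<Rightarrow> 'a \<Rightarrow> nat \<Rightarrow> 'a" where "pos h x k = fst (scheme h x k)"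
definition vel :: "real \<Rightarrow> 'a \<Rightarrow> nat \<Rightarrow> 'a" where "vel h x k = snd (scheme h x k)"

lemma pos_0 [simp]: "pos h x 0 = x"
  and vel_0 [simp]: "vel h x 0 = 0"
  and vel_Suc: "vel h x (Suc k) = vel h x k + h *\<^sub>R F (pos h x k)"
  and pos_Suc: "pos h x (Suc k) = pos h x k + h *\<^sub>R vel h x (Suc k)"
  by (simp_all add: pos_def vel_def Let_def)

lemma inner_F_sgn: "x \<noteq> 0 \<Longrightarrow> F x \<bullet> sgn x = (F x \<bullet> x) / norm x"
  by (simp add: sgn_div_norm divide_inverse mult.commute)

lemma inner_F_sgn_pos: "x \<noteq> 0 \<Longrightarrow> 0 < F x \<bullet> sgn x"
  by (simp add: inner_F_sgn repulsive)

section \<open>Outward motion and discrete convexity of the norm along the scheme\<close>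

context
  fixes h :: real and x :: 'a
  assumes h: "0 < h" and x: "x \<noteq> 0"
begin

text \<open>The kick adds a positive radial component; the drift then lowers neither the norm, by
  the subgradient inequality, nor the radial velocity, by \<open>inner_sgn_mono\<close>. One
  induction carries both claims, because the kick is known to point outwards only at a nonzero
  position.\<close>

lemma scheme_outgoing: "norm x \<le> norm (pos h x k) \<and> 0 \<le> vel h x k \<bullet> sgn (pos h x k)"
proof (induction k)
  case (Suc k)
  then have "pos h x k \<noteq> 0" using x by auto
  then have "0 < h * (F (pos h x k) \<bullet> sgn (pos h x k))" using inner_F_sgn_pos h by simp
  then have pos: "0 \<le> vel h x (Suc k) \<bullet> sgn (pos h x k)"
    using Suc by (simp add: vel_Suc inner_add_left)
  have "norm (pos h x k) \<le> norm (pos h x (Suc k))"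
    using norm_add_scaleR_ge[of "pos h x k" h "vel h x (Suc k)"] mult_nonneg_nonneg[OF less_imp_le[OF h] pos]
    unfolding pos_Suc[of h x k] by linarith
  moreover have "0 \<le> vel h x (Suc k) \<bullet> sgn (pos h x (Suc k))"
    using pos inner_sgn_mono[OF h, of "vel h x (Suc k)" "pos h x k"] unfolding pos_Suc[of h x k] by linarith
  ultimately show ?case using Suc by linarith
qed simp

lemma norm_pos_ge: "norm x \<le> norm (pos h x k)"
  using scheme_outgoing by blast

lemma pos_nonzero: "pos h x k \<noteq> 0"
  using norm_pos_ge[of k] x by auto

text \<open>The velocity after the kick is paired with the position before the drift. This is the
  slope of \<open>norm\<close> at the start of the drift, hence a lower bound for its growth rate
  over the step.\<close>

definition radial :: "nat \<Rightarrow> real" where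
  "radial k = vel h x (Suc k) \<bullet> sgn (pos h x k)"

lemma radial_ge: "h * (F (pos h x k) \<bullet> sgn (pos h x k)) \<le> radial k"
  using scheme_outgoing[of k] by (simp add: radial_def vel_Suc inner_add_left)

lemma radial_pos: "0 < radial k"
  using radial_ge[of k] mult_pos_pos[OF h inner_F_sgn_pos[OF pos_nonzero[of k]]] by linarith

text \<open>Moving along the drift does not lower the radial component of the fixed velocity, and
  the next kick adds \<open>h\<close> times the radial force.\<close>

lemma radial_Suc:
  "radial k + h * (F (pos h x (Suc k)) \<bullet> sgn (pos h x (Suc k))) \<le> radial (Suc k)"
  using inner_sgn_mono[OF h, of "vel h x (Suc k)" "pos h x k"]
  unfolding radial_def vel_Suc[of h x "Suc k"] pos_Suc[of h x k, symmetric] inner_add_left by simp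

lemma norm_pos_Suc: "norm (pos h x k) + h * radial k \<le> norm (pos h x (Suc k))"
  using norm_add_scaleR_ge[of "pos h x k" h "vel h x (Suc k)"]
  unfolding pos_Suc[of h x k, symmetric] radial_def .

lemma radial_mono: "k \<le> l \<Longrightarrow> radial k \<le> radial l"
proof (rule lift_Suc_mono_le[of radial])
  show "radial n \<le> radial (Suc n)" for n
    using radial_Suc[of n] mult_pos_pos[OF h inner_F_sgn_pos[OF pos_nonzero[of "Suc n"]]] by linarith
qed

lemma norm_pos_linear: "norm (pos h x k) + real j * (h * radial k) \<le> norm (pos h x (k + j))"
proof (induction j)
  case (Suc j)
  have "h * radial k \<le> h * radial (k + j)" using radial_mono[of k "k + j"] h by simp
  then show ?case using Suc norm_pos_Suc[of "k + j"] by (simp add: algebra_simps)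
qed simp

lemma radial_le_norm_vel: "radial k \<le> norm (vel h x (Suc k))"
  unfolding radial_def by (rule norm_ge_inner_sgn)

text \<open>These signs hold for every step size. They keep 0 off the segments from a position to
  the next position and to the next velocity.\<close>

lemma inner_pos_Suc: "0 < pos h x k \<bullet> pos h x (Suc k)"
  and inner_pos_vel: "0 < pos h x k \<bullet> vel h x (Suc k)"
proof -
  show 1: "0 < pos h x k \<bullet> vel h x (Suc k)"
    using radial_pos[of k] pos_nonzero[of k] unfolding radial_def
    by (simp add: sgn_div_norm inner_commute zero_less_mult_iff)
  have "0 < pos h x k \<bullet> pos h x k" using pos_nonzero by simp
  then show "0 < pos h x k \<bullet> pos h x (Suc k)"
    using mult_pos_pos[OF h 1] unfolding pos_Suc[of h x k] inner_add_right inner_scaleR_right by linarith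
qed

end

section \<open>Shooting for the final direction by homotopy\<close>

lemma continuous_on_scheme:
  assumes "0 < h" "0 \<notin> S"
  shows "continuous_on S (\<lambda>x. pos h x k)" "continuous_on S (\<lambda>x. vel h x k)"
proof -
  have "continuous_on S (\<lambda>x. pos h x k) \<and> continuous_on S (\<lambda>x. vel h x k)"
  proof (induction k)
    case (Suc k)
    have "pos h x k \<noteq> 0" if "x \<in> S" for x using pos_nonzero[of h x k] assms that by auto
    then have "continuous_on S (\<lambda>x. F (pos h x k))"
      using Suc by (intro continuous_on_compose2[OF cont_F]) auto
    then have "continuous_on S (\<lambda>x. vel h x (Suc k))"
      unfolding vel_Suc using Suc by (intro continuous_intros) auto
    then show ?case unfolding pos_Suc using Suc by (intro conjI continuous_intros) auto
  qed (simp add: continuous_on_id)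
  then show "continuous_on S (\<lambda>x. pos h x k)" "continuous_on S (\<lambda>x. vel h x k)" by auto
qed

text \<open>Straight-line homotopies lead from the inclusion to the starting points, from each
  position to the next one, and finally from a position to the following velocity. The index of the
  velocity is a successor because the initial velocity is 0.\<close>

lemma shooting:
  fixes R :: "'a \<Rightarrow> real"
  assumes h: "0 < h" and R: "continuous_on (sphere 0 1) R" "\<And>\<theta>. norm \<theta> = 1 \<Longrightarrow> 0 < R \<theta>"
    and e: "norm e = 1"
  obtains \<theta> r where "norm \<theta> = 1" "0 < r" "vel h (R \<theta> *\<^sub>R \<theta>) (Suc k) = r *\<^sub>R e"
proof -
  let ?S = "sphere (0::'a) 1"
  let ?x = "\<lambda>\<theta>. R \<theta> *\<^sub>R \<theta>"
  have nz: "?x \<theta> \<noteq> 0" if "\<theta> \<in> ?S" for \<theta> using R(2)[of \<theta>] that by auto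
  have cx: "continuous_on ?S ?x" by (intro continuous_intros R)
  have cp: "continuous_on ?S (\<lambda>\<theta>. pos h (?x \<theta>) k)" for k
    by (rule continuous_on_compose2[OF continuous_on_scheme(1)[OF h, of "- {0}"] cx]) (use nz in auto)
  have cv: "continuous_on ?S (\<lambda>\<theta>. vel h (?x \<theta>) k)" for k
    by (rule continuous_on_compose2[OF continuous_on_scheme(2)[OF h, of "- {0}"] cx]) (use nz in auto)
  have "homotopic_with_canon (\<lambda>_. True) ?S (- {0}) id (\<lambda>\<theta>. pos h (?x \<theta>) k)" for k
  proof (induction k)
    case 0
    have "0 < \<theta> \<bullet> ?x \<theta>" if "\<theta> \<in> ?S" for \<theta>
      using R(2)[of \<theta>] that by (simp add: dot_square_norm)
    then show ?case
      by (intro homotopic_with_linear zero_notin_closed_segment) (simp_all add: cx)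
  next
    case (Suc k)
    moreover have "homotopic_with_canon (\<lambda>_. True) ?S (- {0}) (\<lambda>\<theta>. pos h (?x \<theta>) k) (\<lambda>\<theta>. pos h (?x \<theta>) (Suc k))"
      using inner_pos_Suc[OF h] nz by (intro homotopic_with_linear cp zero_notin_closed_segment) auto
    ultimately show ?case by (rule homotopic_with_trans)
  qed
  moreover have "homotopic_with_canon (\<lambda>_. True) ?S (- {0}) (\<lambda>\<theta>. pos h (?x \<theta>) k) (\<lambda>\<theta>. vel h (?x \<theta>) (Suc k))"
    using inner_pos_vel[OF h] nz by (intro homotopic_with_linear cp cv zero_notin_closed_segment) auto
  ultimately have "homotopic_with_canon (\<lambda>_. True) ?S (- {0}) id (\<lambda>\<theta>. vel h (?x \<theta>) (Suc k))"
    by (rule homotopic_with_trans)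
  then show ?thesis using e by (rule homotopic_inclusion_meets_ray) (rule that)
qed

section \<open>Bounds for the force outside a ball and on annuli\<close>

lemma decay_outside:
  assumes "0 < \<rho>"
  obtains K where "0 < K" "\<And>x. \<rho> \<le> norm x \<Longrightarrow> norm (F x) * (norm x)\<^sup>2 \<le> K"
proof -
  let ?A = "cball (0::'a) r\<^sub>0 - ball 0 \<rho>"
  have "compact ?A" by (intro compact_diff) auto
  moreover have "continuous_on ?A (\<lambda>x. norm (F x) * (norm x)\<^sup>2)"
    by (intro continuous_intros continuous_on_subset[OF cont_F]) (use assms in auto)
  ultimately have "bounded ((\<lambda>x. norm (F x) * (norm x)\<^sup>2) ` ?A)"
    by (intro compact_imp_bounded compact_continuous_image)
  then obtain B where B: "\<And>x. x \<in> ?A \<Longrightarrow> norm (F x) * (norm x)\<^sup>2 \<le> B"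
    unfolding bounded_real by (meson abs_le_D1 imageI)
  show ?thesis
  proof
    show "0 < max 1 (max B M)" by simp
    fix x :: 'a assume "\<rho> \<le> norm x"
    then show "norm (F x) * (norm x)\<^sup>2 \<le> max 1 (max B M)"
      using B[of x] decay[of x] by (cases "r\<^sub>0 \<le> norm x") auto
  qed
qed

text \<open>Compactness yields this on an annulus only, as the force decays at infinity. It is
  applied to the first unit of time, in which the particle gains its speed.\<close>

lemma radial_force_bounded_below:
  assumes "0 < \<rho>"
  obtains m where "0 < m" "\<And>x. \<rho> \<le> norm x \<Longrightarrow> norm x \<le> R \<Longrightarrow> m \<le> F x \<bullet> sgn x"
proof -
  let ?A = "cball 0 R - ball (0::'a) \<rho>"
  have A: "compact ?A" by (intro compact_diff) auto
  show ?thesis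
  proof (cases "?A = {}")
    case True
    then have "\<not> (\<rho> \<le> norm x \<and> norm x \<le> R)" for x :: 'a
      by (metis DiffI dist_0_norm empty_iff linorder_not_le mem_ball mem_cball)
    then show ?thesis using that[of 1] by (metis zero_less_one)
  next
    case False
    have "continuous_on ?A (\<lambda>x. F x \<bullet> sgn x)"
      by (intro continuous_intros continuous_on_subset[OF cont_F]) (use assms in auto)
    then obtain y where y: "y \<in> ?A" "\<And>x. x \<in> ?A \<Longrightarrow> F y \<bullet> sgn y \<le> F x \<bullet> sgn x"
      using continuous_attains_inf[OF A False] by blast
    show ?thesis
    proof (rule that)
      show "0 < F y \<bullet> sgn y" using y(1) assms by (intro inner_F_sgn_pos) auto
      show "F y \<bullet> sgn y \<le> F x \<bullet> sgn x" if "\<rho> \<le> norm x" "norm x \<le> R" for x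
        using that by (intro y(2)) auto
    qed
  qed
qed

end

subsection \<open>Step functions and compactness\<close>

lemma floor_divide_bounds:
  fixes t h :: real
  assumes "0 < h" "0 \<le> t"
  shows "real (nat \<lfloor>t / h\<rfloor>) * h \<le> t" "t < real (Suc (nat \<lfloor>t / h\<rfloor>)) * h"
proof -
  have eq: "real (nat \<lfloor>t / h\<rfloor>) = of_int \<lfloor>t / h\<rfloor>" using assms by simp
  show "real (nat \<lfloor>t / h\<rfloor>) * h \<le> t"
    unfolding eq by (rule pos_le_divide_eq[OF assms(1), THEN iffD1, OF of_int_floor_le])
  have "t / h < of_int \<lfloor>t / h\<rfloor> + 1" by linarith
  then show "t < real (Suc (nat \<lfloor>t / h\<rfloor>)) * h"
    using assms unfolding of_nat_Suc eq by (simp add: field_simps)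
qed

lemma floor_divide_eq:
  fixes s h :: real
  assumes "0 < h" "real k * h \<le> s" "s < real (Suc k) * h"
  shows "nat \<lfloor>s / h\<rfloor> = k"
proof -
  have "\<lfloor>s / h\<rfloor> = int k" using assms by (intro floor_unique) (simp_all add: field_simps)
  then show ?thesis by simp
qed

lemma has_integral_step_function:
  fixes g :: "nat \<Rightarrow> 'a::euclidean_space" and h :: real
  assumes h: "0 < h"
  shows "((\<lambda>s. g (nat \<lfloor>s / h\<rfloor>)) has_integral h *\<^sub>R (\<Sum>j<k. g j)) {0..real k * h}"
proof (induction k)
  case (Suc k)
  have "((\<lambda>s. g k) has_integral (real (Suc k) * h - real k * h) *\<^sub>R g k) {real k * h..real (Suc k) * h}"
    by (rule has_integral_const_real[THEN has_integral_eq_rhs]) (use h in simp)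
  \<comment> \<open>At the right end point the floor has already jumped to \<open>Suc k\<close>;
    this single point is discarded.\<close>
  then have "((\<lambda>s. g (nat \<lfloor>s / h\<rfloor>)) has_integral h *\<^sub>R g k) {real k * h..real (Suc k) * h}"
    by (rule has_integral_spike_finite[of "{real (Suc k) * h}", rotated 2, THEN has_integral_eq_rhs])
      (auto simp: algebra_simps intro!: arg_cong[where f = g] floor_divide_eq[OF h])
  from has_integral_combine[OF _ _ Suc this] h show ?case by (simp add: scaleR_add_right)
qed (use has_integral_refl(2)[of _ "0::real"] in simp)

text \<open>The sum covers the full cells before \<open>t\<close>. The remaining piece is shorter
  than \<open>h\<close>, and the integrand is bounded by \<open>G\<close>.\<close>

lemma integral_step_function_error:
  fixes g :: "nat \<Rightarrow> 'a::euclidean_space" and h :: real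
  assumes h: "0 < h" and t: "0 \<le> t" and g: "\<And>j. norm (g j) \<le> G"
  shows "(\<lambda>s. g (nat \<lfloor>s / h\<rfloor>)) integrable_on {0..t}"
    and "norm (h *\<^sub>R (\<Sum>j<nat \<lfloor>t / h\<rfloor>. g j) - integral {0..t} (\<lambda>s. g (nat \<lfloor>s / h\<rfloor>))) \<le> G * h"
proof -
  define k where "k = nat \<lfloor>t / h\<rfloor>"
  let ?f = "\<lambda>s. g (nat \<lfloor>s / h\<rfloor>)"
  have k: "real k * h \<le> t" "t < real (Suc k) * h"
    unfolding k_def by (rule floor_divide_bounds[OF h t])+
  have "?f integrable_on {0..real (Suc k) * h}"
    using has_integral_step_function[OF h] by blast
  then show int: "?f integrable_on {0..t}"
    by (rule integrable_on_subinterval) (use k in auto)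
  have G: "0 \<le> G" using norm_ge_zero g order_trans by blast
  have k0: "0 \<le> real k * h" using h by simp
  have "integral {0..real k * h} ?f + integral {real k * h..t} ?f = integral {0..t} ?f"
    by (rule Henstock_Kurzweil_Integration.integral_combine[OF k0 k(1) int])
  moreover have "integral {0..real k * h} ?f = h *\<^sub>R (\<Sum>j<k. g j)"
    by (rule integral_unique[OF has_integral_step_function[OF h]])
  moreover have "norm (integral {real k * h..t} ?f) \<le> G * (t - real k * h)"
  proof -
    have "?f integrable_on {real k * h..t}"
      by (rule integrable_on_subinterval[OF int]) (use k0 in auto)
    then have "norm (integral (cbox (real k * h) t) ?f) \<le> G * measure lborel (cbox (real k * h) t)"
      by (intro has_integral_bound[OF G integrable_integral] g) simp
    then show ?thesis using k by simp
  qed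
  moreover have "G * (t - real k * h) \<le> G * h"
    using k G by (intro mult_left_mono) (simp_all add: algebra_simps)
  ultimately show "norm (h *\<^sub>R (\<Sum>j<nat \<lfloor>t / h\<rfloor>. g j) - integral {0..t} ?f) \<le> G * h"
    unfolding k_def[symmetric] by (smt (verit, ccfv_threshold) add_diff_cancel_left' norm_minus_commute)
qed

text \<open>A variant of Arzela-Ascoli for step functions, which are Lipschitz only up to a
  vanishing error: a diagonal sequence converges at nonnegative rationals, and the Lipschitz
  estimate carries the Cauchy property to all times. Pointwise convergence is enough for dominated
  convergence later.\<close>

lemma almost_lipschitz_convergent_subsequence:
  fixes U :: "nat \<Rightarrow> real \<Rightarrow> 'a::euclidean_space"
  assumes bound: "\<And>n t. 0 \<le> t \<Longrightarrow> norm (U n t) \<le> B * (1 + t)"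
    and lip: "\<And>n s t. 0 \<le> s \<Longrightarrow> s \<le> t \<Longrightarrow> norm (U n t - U n s) \<le> L * (t - s + \<epsilon> n)"
    and L: "0 < L" and \<epsilon>: "\<epsilon> \<longlonglongrightarrow> 0"
  obtains d :: "nat \<Rightarrow> nat" where "strict_mono d" "\<And>t. 0 \<le> t \<Longrightarrow> convergent (\<lambda>n. U (d n) t)"
proof -
  let ?Q = "{q \<in> \<rat>. 0 \<le> (q::real)}"
  have cQ: "countable ?Q" by (rule countable_subset[OF _ countable_rat]) auto
  \<comment> \<open>The given bound grows with time; dividing by \<open>1 + q\<close> makes it
    uniform, as the diagonal extraction requires.\<close>
  have "norm (U n q /\<^sub>R (1 + q)) \<le> B" if "q \<in> ?Q" for n q
    using bound[of q n] that by (simp add: field_simps)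
  from function_convergent_subsequence[of ?Q "\<lambda>n q. U n q /\<^sub>R (1 + q)" B, OF cQ this]
  obtain d where d: "strict_mono (d :: nat \<Rightarrow> nat)"
    and conv: "\<And>q. q \<in> ?Q \<Longrightarrow> \<exists>l. (\<lambda>n. U (d n) q /\<^sub>R (1 + q)) \<longlonglongrightarrow> l"
    by blast
  have convQ: "Cauchy (\<lambda>n. U (d n) q)" if q: "q \<in> ?Q" for q
  proof -
    obtain l where "(\<lambda>n. U (d n) q /\<^sub>R (1 + q)) \<longlonglongrightarrow> l" using conv[OF q] ..
    from tendsto_scaleR[OF tendsto_const[of "1 + q"] this] q
    have "(\<lambda>n. U (d n) q) \<longlonglongrightarrow> (1 + q) *\<^sub>R l" by simp
    then show ?thesis by (rule LIMSEQ_imp_Cauchy)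
  qed
  have \<epsilon>d: "(\<lambda>n. \<epsilon> (d n)) \<longlonglongrightarrow> 0" using LIMSEQ_subseq_LIMSEQ[OF \<epsilon> d] by (simp add: o_def)
  have "Cauchy (\<lambda>n. U (d n) t)" if t: "0 \<le> t" for t
  proof (rule metric_CauchyI)
    fix \<eta> :: real assume \<eta>: "0 < \<eta>"
    \<comment> \<open>Both \<open>q - t\<close> and the error stay below \<delta>, so moving from
      \<open>t\<close> to \<open>q\<close> costs less than \<open>L * (2 * \<delta>)\<close>, a
      third of \<eta>.\<close>
    define \<delta> where "\<delta> = \<eta> / (6 * L)"
    have \<delta>: "0 < \<delta>" using \<eta> L by (simp add: \<delta>_def)
    obtain q where q: "q \<in> \<rat>" "t < q" "q < t + \<delta>" using Rats_dense_in_real[of t "t + \<delta>"] \<delta> by auto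
    obtain N1 where N1: "\<And>m n. N1 \<le> m \<Longrightarrow> N1 \<le> n \<Longrightarrow> dist (U (d m) q) (U (d n) q) < \<eta> / 3"
      using metric_CauchyD[OF convQ[of q], of "\<eta> / 3"] q t \<eta> by auto
    obtain N2 where N2: "\<And>n. N2 \<le> n \<Longrightarrow> \<bar>\<epsilon> (d n)\<bar> < \<delta>"
      using LIMSEQ_D[OF \<epsilon>d \<delta>] by auto
    have near: "dist (U (d n) q) (U (d n) t) < \<eta> / 3" if "N2 \<le> n" for n
    proof -
      have "norm (U (d n) q - U (d n) t) \<le> L * (q - t + \<epsilon> (d n))" using lip t q by simp
      also have "\<dots> < L * (2 * \<delta>)" using L q N2[OF that] by (intro mult_strict_left_mono) auto
      also have "\<dots> = \<eta> / 3" using L by (simp add: \<delta>_def)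
      finally show ?thesis by (simp add: dist_norm)
    qed
    show "\<exists>N. \<forall>m\<ge>N. \<forall>n\<ge>N. dist (U (d m) t) (U (d n) t) < \<eta>"
    proof (intro exI allI impI)
      fix m n assume "max N1 N2 \<le> m" "max N1 N2 \<le> n"
      then have "dist (U (d m) q) (U (d n) q) < \<eta> / 3" "dist (U (d m) q) (U (d m) t) < \<eta> / 3"
        "dist (U (d n) q) (U (d n) t) < \<eta> / 3"
        using N1 near by auto
      then show "dist (U (d m) t) (U (d n) t) < \<eta>" by metric
    qed
  qed
  then show ?thesis using that[OF d] by (simp add: convergent_eq_Cauchy Cauchy_convergent_iff)
qed

lemma integral_has_vector_derivative_atLeast:
  fixes f :: "real \<Rightarrow> 'a::banach"
  assumes "continuous_on {0..} f" "0 \<le> t"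
  shows "((\<lambda>t. integral {0..t} f) has_vector_derivative f t) (at t within {0..})"
proof -
  have "((\<lambda>t. integral {0..t} f) has_vector_derivative f t) (at t within {0..t + 1})"
    using assms by (intro integral_has_vector_derivative continuous_on_subset[OF assms(1)]) auto
  moreover have "at t within {0..t + 1} = at t within {0..}"
    by (rule at_within_nhd[of t "{..<t + 1}"]) auto
  ultimately show ?thesis by simp
qed

subsection \<open>Uniform estimates and the limit orbit\<close>

context repulsive_force
begin

lemma vel_eq_sum: "vel h x k = h *\<^sub>R (\<Sum>j<k. F (pos h x j))"
  by (induction k) (simp_all add: vel_Suc scaleR_add_right)

lemma pos_eq_sum: "pos h x k = x + h *\<^sub>R (\<Sum>j<k. vel h x (Suc j))"
  by (induction k) (simp_all add: pos_Suc scaleR_add_right)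

lemma norm_pos_diff_le:
  assumes "0 \<le> h" "\<And>j. norm (vel h x j) \<le> C"
  shows "norm (pos h x (k + j) - pos h x k) \<le> C * (real j * h)"
proof (induction j)
  case (Suc j)
  have "norm (h *\<^sub>R vel h x (Suc (k + j))) \<le> C * h"
    using assms mult_left_mono[OF assms(2) assms(1)] by (simp add: mult.commute)
  then have "norm ((pos h x (k + j) - pos h x k) + h *\<^sub>R vel h x (Suc (k + j))) \<le> C * (real j * h) + C * h"
    using Suc by (rule norm_triangle_mono[rotated])
  then show ?case by (simp add: pos_Suc algebra_simps)
qed simp

text \<open>With \<open>h = 1 / real (Suc n)\<close> one unit of time is exactly
  \<open>Suc n\<close> steps. In this time the particle stays in a fixed annulus and gains radial
  speed \<open>m\<close>, which it never loses; so the norm grows linearly. Inverse-square decay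
  then bounds the velocity increments by a telescoping sum.\<close>

lemma uniform_estimates:
  assumes \<rho>: "0 < \<rho>"
  obtains c m C G where "0 < c" "0 < m" "0 < C"
    "\<And>x n h k. \<lbrakk>h = 1 / real (Suc n); \<rho> \<le> norm x; norm x \<le> R\<rbrakk> \<Longrightarrow>
        c * (1 + real k * h) \<le> norm (pos h x k)"
    "\<And>x n h k l. \<lbrakk>h = 1 / real (Suc n); \<rho> \<le> norm x; norm x \<le> R; k \<le> l\<rbrakk> \<Longrightarrow>
        norm (vel h x l - vel h x k) \<le> C / (1 + real k * h)"
    "\<And>x n h k. \<lbrakk>h = 1 / real (Suc n); \<rho> \<le> norm x; norm x \<le> R; n \<le> k\<rbrakk> \<Longrightarrow> m \<le> norm (vel h x (Suc k))"
    "\<And>x n h k. \<lbrakk>h = 1 / real (Suc n); \<rho> \<le> norm x; norm x \<le> R\<rbrakk> \<Longrightarrow> norm (F (pos h x k)) \<le> G"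
proof -
  obtain K where K: "0 < K" "\<And>x. \<rho> \<le> norm x \<Longrightarrow> norm (F x) * (norm x)\<^sup>2 \<le> K"
    by (rule decay_outside[OF \<rho>]) (rule that)
  define G where "G = K / \<rho>\<^sup>2"
  have G0: "0 < G" using K \<rho> by (simp add: G_def)
  have FG: "norm (F x) \<le> G" if "\<rho> \<le> norm x" for x
  proof -
    have "norm (F x) * \<rho>\<^sup>2 \<le> norm (F x) * (norm x)\<^sup>2"
      using that \<rho> by (intro mult_left_mono power_mono) auto
    then show ?thesis using K(2)[OF that] \<rho> by (simp add: G_def field_simps)
  qed
  \<comment> \<open>During the first unit of time the speed is at most \<open>G\<close>, so
    \<open>R + G\<close> bounds the distance reached.\<close>
  obtain m where m: "0 < m" "\<And>x. \<rho> \<le> norm x \<Longrightarrow> norm x \<le> R + G \<Longrightarrow> m \<le> F x \<bullet> sgn x"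
    by (rule radial_force_bounded_below[OF \<rho>]) (rule that)
  \<comment> \<open>The first entry serves the initial unit of time, where
    \<open>1 + real k * h\<close> is at most 2; the second is the later slope.\<close>
  define c where "c = min (\<rho> / 2) m"
  have c: "0 < c" using \<rho> m by (simp add: c_def)
  define C where "C = 2 * (K / c\<^sup>2)"
  have C: "0 < C" using K c by (simp add: C_def)
  {
    fix x :: 'a and n :: nat and h :: real
    assume h_def: "h = 1 / real (Suc n)" and x: "\<rho> \<le> norm x" "norm x \<le> R"
    have h: "0 < h" "h \<le> 1" and nh: "real (Suc n) * h = 1" by (auto simp: h_def)
    have x0: "x \<noteq> 0" using x \<rho> by auto
    have \<rho>pos: "\<rho> \<le> norm (pos h x k)" for k using norm_pos_ge[OF h(1) x0, of k] x by linarith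
    have Fpos: "norm (F (pos h x k)) \<le> G" for k by (rule FG[OF \<rho>pos])
    have vel: "norm (vel h x k) \<le> real k * (h * G)" for k
    proof (induction k)
      case (Suc k)
      have "norm (h *\<^sub>R F (pos h x k)) \<le> h * G" using Fpos[of k] h by simp
      with Suc have "norm (vel h x k + h *\<^sub>R F (pos h x k)) \<le> real k * (h * G) + h * G"
        by (rule norm_triangle_mono)
      then show ?case by (simp add: vel_Suc algebra_simps)
    qed simp
    have pos: "norm (pos h x k) \<le> R + real k * h * G" if "k \<le> Suc n" for k
      using that
    proof (induction k)
      case (Suc k)
      have "real (Suc k) * (h * G) \<le> real (Suc n) * (h * G)"
        using Suc.prems h G0 by (intro mult_right_mono) auto
      also have "\<dots> = G" using nh by (simp flip: mult.assoc)
      finally have "norm (vel h x (Suc k)) \<le> G" using vel[of "Suc k"] by linarith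
      then have "norm (h *\<^sub>R vel h x (Suc k)) \<le> h * G" using h by simp
      moreover have "norm (pos h x k) \<le> R + real k * h * G" using Suc by simp
      ultimately have "norm (pos h x k + h *\<^sub>R vel h x (Suc k)) \<le> R + real k * h * G + h * G"
        by (intro norm_triangle_mono)
      then show ?case by (simp add: pos_Suc algebra_simps)
    qed (use x in simp)
    have force: "m \<le> F (pos h x k) \<bullet> sgn (pos h x k)" if "k \<le> n" for k
    proof (rule m(2)[OF \<rho>pos])
      have "real k * h \<le> real (Suc n) * h" using that h by (intro mult_right_mono) auto
      then have "real k * h * G \<le> 1 * G" using G0 nh by (intro mult_right_mono) auto
      then show "norm (pos h x k) \<le> R + G" using pos[of k] that by simp
    qed
    \<comment> \<open>Each of these kicks adds at least \<open>h * m\<close> to the radial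
      velocity.\<close>
    have "real (Suc k) * h * m \<le> radial h x k" if "k \<le> n" for k
      using that
    proof (induction k)
      case 0
      have "h * m \<le> h * (F (pos h x 0) \<bullet> sgn (pos h x 0))" using force[of 0] h by simp
      then show ?case using radial_ge[OF h(1) x0, of 0] by simp
    next
      case (Suc k)
      have "h * m \<le> h * (F (pos h x (Suc k)) \<bullet> sgn (pos h x (Suc k)))"
        using force[OF Suc.prems] h by simp
      then show ?case using Suc radial_Suc[OF h(1) x0, of k] by (simp add: algebra_simps)
    qed
    from this[of n] have "m \<le> radial h x n" using nh by simp
    then have rad: "m \<le> radial h x k" if "n \<le> k" for k
      using radial_mono[OF h(1) x0 that] by linarith
    have velm: "m \<le> norm (vel h x (Suc k))" if "n \<le> k" for k
      using rad[OF that] radial_le_norm_vel[OF h(1) x0, of k] by linarith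
    have lin: "c * (1 + real k * h) \<le> norm (pos h x k)" for k
    proof (cases "k \<le> n")
      case True
      then have "real k * h \<le> real (Suc n) * h" using h by (intro mult_right_mono) auto
      then have "real k * h \<le> 1" unfolding nh .
      then have "c * (1 + real k * h) \<le> \<rho> / 2 * 2"
        using h c \<rho> by (intro mult_mono) (auto simp: c_def)
      then show ?thesis using \<rho>pos[of k] by simp
    next
      case False
      then obtain j where j: "k = n + j" by (metis le_add_diff_inverse nat_le_linear)
      have "real n * h \<le> 1" using nh h by (simp add: algebra_simps)
      then have "c * (1 + real k * h) \<le> c * (2 + real j * h)"
        using c by (intro mult_left_mono) (auto simp: j algebra_simps)
      also have "\<dots> = c * 2 + real j * (h * c)" by (simp add: algebra_simps)
      also have "\<dots> \<le> \<rho> + real j * (h * radial h x n)"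
        using rad[of n] h by (intro add_mono mult_left_mono) (auto simp: c_def)
      also have "\<dots> \<le> norm (pos h x k)"
        using norm_pos_linear[OF h(1) x0, of n j] \<rho>pos[of n] unfolding j by linarith
      finally show ?thesis .
    qed
    have incr: "norm (h *\<^sub>R F (pos h x k)) \<le> C * (1 / (1 + real k * h) - 1 / (1 + real (Suc k) * h))" for k
    proof -
      define a where "a = 1 + real k * h"
      have a: "1 \<le> a" using h by (simp add: a_def)
      have "(c * a)\<^sup>2 \<le> (norm (pos h x k))\<^sup>2"
        using lin[of k] a c by (intro power_mono) (auto simp: a_def)
      then have "norm (F (pos h x k)) * (c * a)\<^sup>2 \<le> norm (F (pos h x k)) * (norm (pos h x k))\<^sup>2"
        by (intro mult_left_mono) auto
      then have "norm (F (pos h x k)) * (c * a)\<^sup>2 \<le> K"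
        using K(2)[OF \<rho>pos[of k]] by linarith
      then have "norm (F (pos h x k)) \<le> K / (c * a)\<^sup>2"
        using a c by (simp add: pos_le_divide_eq)
      then have "h * norm (F (pos h x k)) \<le> h * (K / (c * a)\<^sup>2)"
        using h by (intro mult_left_mono) auto
      also have "\<dots> = (K / c\<^sup>2) * (h / (a * a))" by (simp add: power2_eq_square mult_ac)
      \<comment> \<open>Since \<open>h \<le> 1 \<le> a\<close>, replacing one factor
        \<open>a\<close> by \<open>(a + h) / 2\<close> only enlarges the quotient. It produces a
        telescoping difference and the factor 2 in \<open>C\<close>.\<close>
      also have "\<dots> \<le> (K / c\<^sup>2) * (h / (a * ((a + h) / 2)))"
        using a h K c by (intro mult_left_mono divide_left_mono) auto
      also have "h / (a * ((a + h) / 2)) = 2 * (1 / a - 1 / (a + h))" using a h by (simp add: field_simps)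
      also have "K / c\<^sup>2 * (2 * (1 / a - 1 / (a + h))) = C * (1 / a - 1 / (a + h))" by (simp add: C_def)
      finally have "norm (h *\<^sub>R F (pos h x k)) \<le> C * (1 / a - 1 / (a + h))" using h by simp
      moreover have "a + h = 1 + real (Suc k) * h" by (simp add: a_def algebra_simps)
      ultimately show ?thesis by (simp only: a_def)
    qed
    have tail: "norm (vel h x l - vel h x k) \<le> C / (1 + real k * h)" if "k \<le> l" for k l
    proof -
      define f where "f j = 1 / (1 + real j * h)" for j
      have "norm (vel h x l - vel h x k) \<le> C * (f k - f l)"
        using that
      proof (induction l rule: dec_induct)
        case (step l)
        have "norm ((vel h x l - vel h x k) + h *\<^sub>R F (pos h x l)) \<le> C * (f k - f l) + C * (f l - f (Suc l))"
          by (intro norm_triangle_mono step.IH incr[of l, folded f_def])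
        then show ?case by (simp add: vel_Suc algebra_simps)
      qed simp
      also have "\<dots> \<le> C * f k"
        using C h by (intro mult_left_mono) (auto simp: f_def)
      finally show ?thesis by (simp add: f_def)
    qed
    note lin tail velm Fpos
  }
  note est = this
  show ?thesis
    by (rule that[OF c m(1) C]) (fact est)+
qed

text \<open>The orbit is a limit of schemes shot so that their final velocities lie on the ray
  through \<open>e\<close>. The tail estimate compares the velocity at time \<open>t\<close> with
  the final one, uniformly in the step, and so survives the limit.\<close>

lemma asymptotic_brake_orbit:
  fixes R :: "'a \<Rightarrow> real"
  assumes R: "continuous_on (sphere 0 1) R" "\<And>\<theta>. norm \<theta> = 1 \<Longrightarrow> 0 < R \<theta>"
    and e: "norm e = 1"
  obtains \<theta> r c C u v where "norm \<theta> = 1" "0 < r" "0 < c" "u 0 = R \<theta> *\<^sub>R \<theta>" "v 0 = 0"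
    "\<And>t. 0 \<le> t \<Longrightarrow> (u has_vector_derivative v t) (at t within {0..})"
    "\<And>t. 0 \<le> t \<Longrightarrow> (v has_vector_derivative F (u t)) (at t within {0..})"
    "\<And>t. 0 \<le> t \<Longrightarrow> c * (1 + t) \<le> norm (u t)"
    "\<And>t. 0 \<le> t \<Longrightarrow> norm (v t - r *\<^sub>R e) \<le> C / (1 + t)"
proof -
  let ?S = "sphere (0::'a) 1"
  have S: "compact ?S" "?S \<noteq> {}" using e by auto
  obtain \<theta>1 where "\<theta>1 \<in> ?S" "\<And>\<theta>. \<theta> \<in> ?S \<Longrightarrow> R \<theta>1 \<le> R \<theta>"
    using continuous_attains_inf[OF S R(1)] by blast
  moreover obtain \<theta>2 where "\<theta>2 \<in> ?S" "\<And>\<theta>. \<theta> \<in> ?S \<Longrightarrow> R \<theta> \<le> R \<theta>2"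
    using continuous_attains_sup[OF S R(1)] by blast
  ultimately obtain \<rho> R' where \<rho>: "0 < \<rho>" and R': "\<And>\<theta>. \<theta> \<in> ?S \<Longrightarrow> \<rho> \<le> R \<theta>" "\<And>\<theta>. \<theta> \<in> ?S \<Longrightarrow> R \<theta> \<le> R'"
    using R(2)[of \<theta>1] by auto
  obtain c m C G where c: "0 < c" and m: "0 < m" and C: "0 < C" and
    lin: "\<And>x n h k. \<lbrakk>h = 1 / real (Suc n); \<rho> \<le> norm x; norm x \<le> R'\<rbrakk> \<Longrightarrow>
        c * (1 + real k * h) \<le> norm (pos h x k)" and
    tail: "\<And>x n h k l. \<lbrakk>h = 1 / real (Suc n); \<rho> \<le> norm x; norm x \<le> R'; k \<le> l\<rbrakk> \<Longrightarrow>
        norm (vel h x l - vel h x k) \<le> C / (1 + real k * h)" and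
    velm: "\<And>x n h k. \<lbrakk>h = 1 / real (Suc n); \<rho> \<le> norm x; norm x \<le> R'; n \<le> k\<rbrakk> \<Longrightarrow> m \<le> norm (vel h x (Suc k))" and
    FG: "\<And>x n h k. \<lbrakk>h = 1 / real (Suc n); \<rho> \<le> norm x; norm x \<le> R'\<rbrakk> \<Longrightarrow> norm (F (pos h x k)) \<le> G"
    by (rule uniform_estimates[OF \<rho>]) (rule that)
  define h where "h n = 1 / real (Suc n)" for n
  have h: "0 < h n" "h n \<le> 1" for n by (auto simp: h_def)
  have h_lim: "h \<longlonglongrightarrow> 0" unfolding h_def by (rule lim_1_over_n[THEN LIMSEQ_Suc])
  \<comment> \<open>More than \<open>Suc n * Suc n\<close> steps of length
    \<open>1 / real (Suc n)\<close> take the final time beyond \<open>Suc n\<close>: it tends to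
    infinity while the step tends to 0.\<close>
  have "\<exists>\<theta> r. norm \<theta> = 1 \<and> 0 < r \<and> vel (h n) (R \<theta> *\<^sub>R \<theta>) (Suc (Suc n * Suc n)) = r *\<^sub>R e" for n
    using shooting[OF h(1) R e] by metis
  then obtain \<Theta> r where \<Theta>: "\<And>n. norm (\<Theta> n) = 1" and r: "\<And>n. 0 < r n"
    and hit: "\<And>n. vel (h n) (R (\<Theta> n) *\<^sub>R \<Theta> n) (Suc (Suc n * Suc n)) = r n *\<^sub>R e"
    by metis
  define x where "x n = R (\<Theta> n) *\<^sub>R \<Theta> n" for n
  have x: "\<rho> \<le> norm (x n)" "norm (x n) \<le> R'" for n
    using R'[of "\<Theta> n"] \<Theta>[of n] R(2)[of "\<Theta> n"] by (auto simp: x_def)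
  define p w where "p n = pos (h n) (x n)" and "w n = vel (h n) (x n)" for n
  have lin: "c * (1 + real k * h n) \<le> norm (p n k)" for n k
    unfolding p_def by (rule lin[OF h_def x])
  have tail: "norm (w n l - w n k) \<le> C / (1 + real k * h n)" if "k \<le> l" for n k l
    unfolding w_def by (rule tail[OF h_def x that])
  have FG: "norm (F (p n k)) \<le> G" for n k
    unfolding p_def by (rule FG[OF h_def x])
  have wC: "norm (w n k) \<le> C" for n k
    using tail[of 0 k n] by (simp add: w_def)
  have w_Suc: "norm (w n (Suc k) - w n k) \<le> G * h n" for n k
    using mult_left_mono[OF FG, of "h n"] h(1)[of n]
    by (simp add: w_def p_def vel_Suc mult.commute)
  have r_eq: "norm (w n (Suc (Suc n * Suc n))) = r n" for n
    using hit[of n] r[of n] e by (simp add: w_def x_def)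
  have rm: "m \<le> r n" for n
    using velm[OF h_def x, of n "Suc n * Suc n" n] r_eq[of n] by (simp add: w_def)
  have rC: "r n \<le> C" for n using wC r_eq by metis
  \<comment> \<open>The lower bound \<open>m\<close> keeps the limit speed positive, so that the
    direction \<open>e\<close> is not lost.\<close>
  have "compact (?S \<times> {m..C})" by (intro compact_Times) auto
  moreover have "\<forall>n. (\<Theta> n, r n) \<in> ?S \<times> {m..C}" using \<Theta> rm rC by auto
  ultimately obtain l a where l: "l \<in> ?S \<times> {m..C}" and a: "strict_mono (a :: nat \<Rightarrow> nat)"
    and al: "((\<lambda>n. (\<Theta> n, r n)) \<circ> a) \<longlonglongrightarrow> l"
    unfolding compact_def by meson
  define k where "k n t = nat \<lfloor>t / h n\<rfloor>" for n and t :: real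
  have k: "real (k n t) * h n \<le> t" "t < real (k n t) * h n + h n" if "0 \<le> t" for n t
    using floor_divide_bounds[OF h(1) that, of n] by (auto simp: k_def algebra_simps)
  have p_lip: "norm (p n (k n t) - p n (k n s)) \<le> C * (t - s + h n)" if "0 \<le> s" "s \<le> t" for n s t
  proof -
    have kk: "k n s \<le> k n t" unfolding k_def
      using that h(1)[of n] by (intro nat_mono floor_mono divide_right_mono) auto
    have "norm (p n (k n t) - p n (k n s)) \<le> C * (real (k n t - k n s) * h n)"
      using norm_pos_diff_le[of "h n" "x n" C "k n s" "k n t - k n s"] wC h(1)[of n] kk
      unfolding p_def w_def by simp
    also have "real (k n t - k n s) * h n = real (k n t) * h n - real (k n s) * h n"
      using kk by (simp add: of_nat_diff left_diff_distrib)
    also have "C * \<dots> \<le> C * (t - s + h n)"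
      using C k[of s n] k[of t n] that by (intro mult_left_mono) auto
    finally show ?thesis .
  qed
  have p0: "p n 0 = x n" "k n 0 = 0" for n by (simp_all add: p_def k_def)
  have p_bound: "norm (p n (k n t)) \<le> (R' + C) * (1 + t)" if "0 \<le> t" for n t
  proof -
    have "norm (p n (k n t)) \<le> norm (x n) + norm (p n (k n t) - p n (k n 0))"
      unfolding p0 by (metis norm_triangle_sub)
    also have "\<dots> \<le> R' + C * (t - 0 + h n)"
      using that by (intro add_mono x p_lip) auto
    also have "\<dots> \<le> R' + C * (1 + t)"
      using C h(2)[of n] by (intro add_left_mono mult_left_mono) auto
    also have "\<dots> \<le> (R' + C) * (1 + t)"
      using x[of 0] \<rho> that by (simp add: algebra_simps)
    finally show ?thesis .
  qed
  have "(\<lambda>n. h (a n)) \<longlonglongrightarrow> 0" using LIMSEQ_subseq_LIMSEQ[OF h_lim a] by (simp add: o_def)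
  from almost_lipschitz_convergent_subsequence[of "\<lambda>n t. p (a n) (k (a n) t)", OF p_bound p_lip C this]
  obtain b where b: "strict_mono (b :: nat \<Rightarrow> nat)"
    and conv: "\<And>t. 0 \<le> t \<Longrightarrow> convergent (\<lambda>n. p (a (b n)) (k (a (b n)) t))"
    by blast
  \<comment> \<open>Two extractions are composed: \<open>a\<close> for starting directions and final
    speeds, \<open>b\<close> for the positions at all times.\<close>
  define d where "d n = a (b n)" for n
  have d: "strict_mono d" using strict_mono_o[OF a b] by (simp add: d_def strict_mono_def)
  have dl: "(\<lambda>n. (\<Theta> (d n), r (d n))) \<longlonglongrightarrow> l"
    using LIMSEQ_subseq_LIMSEQ[OF al b] by (simp add: o_def d_def)
  have hd: "(\<lambda>n. h (d n)) \<longlonglongrightarrow> 0" using LIMSEQ_subseq_LIMSEQ[OF h_lim d] by (simp add: o_def)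
  define u where "u t = lim (\<lambda>n. p (d n) (k (d n) t))" for t
  have u: "(\<lambda>n. p (d n) (k (d n) t)) \<longlonglongrightarrow> u t" if "0 \<le> t" for t
    using conv[OF that] unfolding u_def d_def by (simp add: convergent_LIMSEQ_iff)
  have u_lin: "c * (1 + t) \<le> norm (u t)" if t: "0 \<le> t" for t
  proof (rule LIMSEQ_le)
    show "(\<lambda>n. c * (1 + (t - h (d n)))) \<longlonglongrightarrow> c * (1 + t)"
      by (rule tendsto_eq_intros hd refl | simp)+
    show "(\<lambda>n. norm (p (d n) (k (d n) t))) \<longlonglongrightarrow> norm (u t)" by (intro tendsto_norm u t)
    have "c * (1 + (t - h (d n))) \<le> norm (p (d n) (k (d n) t))" for n
    proof -
      have "c * (1 + (t - h (d n))) \<le> c * (1 + real (k (d n) t) * h (d n))"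
        using c k(2)[OF t, of "d n"] by (intro mult_left_mono) auto
      then show ?thesis using lin order_trans by blast
    qed
    then show "\<exists>N. \<forall>n\<ge>N. c * (1 + (t - h (d n))) \<le> norm (p (d n) (k (d n) t))" by blast
  qed
  have p_nz: "p n j \<noteq> 0" for n j
  proof -
    have "0 < c * (1 + real j * h n)" using c h(1)[of n] by (simp add: add_pos_nonneg)
    then show ?thesis using lin[of j n] by auto
  qed
  have u_nz: "u t \<noteq> 0" if "0 \<le> t" for t
    using u_lin[OF that] mult_pos_pos[OF c, of "1 + t"] that by auto
  have Fu: "(\<lambda>n. F (p (d n) (k (d n) t))) \<longlonglongrightarrow> F (u t)" if "0 \<le> t" for t
    using u_nz[OF that] p_nz by (intro continuous_on_tendsto_compose[OF cont_F u[OF that]]) auto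

  \<comment> \<open>Defining \<open>v\<close> as an integral rather than as a limit gives its
    derivative by the fundamental theorem. That the discrete velocities converge to it follows from
    dominated convergence with the constant bound \<open>G\<close>.\<close>
  define v where "v t = integral {0..t} (\<lambda>s. F (u s))" for t
  have stepF: "(\<lambda>s. F (p n (k n s))) integrable_on {0..t}"
    "norm (w n (k n t) - integral {0..t} (\<lambda>s. F (p n (k n s)))) \<le> G * h n" if "0 \<le> t" for n t
    using integral_step_function_error[OF h(1) that, of "\<lambda>j. F (p n j)" G n] FG
    unfolding k_def w_def vel_eq_sum p_def by auto
  have Fu_int: "(\<lambda>s. F (u s)) integrable_on {0..t}"
    and Fu_lim: "(\<lambda>n. integral {0..t} (\<lambda>s. F (p (d n) (k (d n) s)))) \<longlonglongrightarrow> v t" if "0 \<le> t" for t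
    unfolding v_def
    using dominated_convergence[of "\<lambda>n s. F (p (d n) (k (d n) s))" "{0..t}" "\<lambda>_. G" "\<lambda>s. F (u s)"]
      stepF(1)[OF that] FG Fu by auto
  have v: "(\<lambda>n. w (d n) (k (d n) t)) \<longlonglongrightarrow> v t" if "0 \<le> t" for t
  proof -
    have "(\<lambda>n. w (d n) (k (d n) t) - integral {0..t} (\<lambda>s. F (p (d n) (k (d n) s)))) \<longlonglongrightarrow> 0"
    proof (rule Lim_null_comparison)
      show "(\<lambda>n. G * h (d n)) \<longlonglongrightarrow> 0" using tendsto_mult_right_zero[OF hd] .
    qed (use stepF(2)[OF that] in simp)
    from tendsto_add[OF this Fu_lim[OF that]] show ?thesis by simp
  qed
  \<comment> \<open>The drift uses the velocity after the kick, which differs by at most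
    \<open>G * h n\<close>.\<close>
  have v': "(\<lambda>n. w (d n) (Suc (k (d n) t))) \<longlonglongrightarrow> v t" if "0 \<le> t" for t
  proof -
    have "(\<lambda>n. w (d n) (Suc (k (d n) t)) - w (d n) (k (d n) t)) \<longlonglongrightarrow> 0"
    proof (rule Lim_null_comparison)
      show "(\<lambda>n. G * h (d n)) \<longlonglongrightarrow> 0" using tendsto_mult_right_zero[OF hd] .
    qed (use w_Suc in simp)
    from tendsto_add[OF this v[OF that]] show ?thesis by simp
  qed
  have stepw: "(\<lambda>s. w n (Suc (k n s))) integrable_on {0..t}"
    "norm (p n (k n t) - x n - integral {0..t} (\<lambda>s. w n (Suc (k n s)))) \<le> C * h n" if "0 \<le> t" for n t
    using integral_step_function_error[OF h(1) that, of "\<lambda>j. w n (Suc j)" C n] wC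
    unfolding k_def p_def pos_eq_sum w_def by auto
  have v_int: "v integrable_on {0..t}"
    and v_lim: "(\<lambda>n. integral {0..t} (\<lambda>s. w (d n) (Suc (k (d n) s)))) \<longlonglongrightarrow> integral {0..t} v" if "0 \<le> t" for t
    using dominated_convergence[of "\<lambda>n s. w (d n) (Suc (k (d n) s))" "{0..t}" "\<lambda>_. C" v]
      stepw(1)[OF that] wC v' by auto
  have x_lim: "(\<lambda>n. x (d n)) \<longlonglongrightarrow> u 0" using u[of 0] by (simp add: p0)
  have u_eq: "u t = u 0 + integral {0..t} v" if "0 \<le> t" for t
  proof -
    have "(\<lambda>n. p (d n) (k (d n) t) - x (d n) - integral {0..t} (\<lambda>s. w (d n) (Suc (k (d n) s)))) \<longlonglongrightarrow> 0"
    proof (rule Lim_null_comparison)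
      show "(\<lambda>n. C * h (d n)) \<longlonglongrightarrow> 0" using tendsto_mult_right_zero[OF hd] .
    qed (use stepw(2)[OF that] in simp)
    moreover have "(\<lambda>n. p (d n) (k (d n) t) - x (d n) - integral {0..t} (\<lambda>s. w (d n) (Suc (k (d n) s))))
        \<longlonglongrightarrow> u t - u 0 - integral {0..t} v"
      by (intro tendsto_diff u that x_lim v_lim)
    ultimately have "u t - u 0 - integral {0..t} v = 0" using LIMSEQ_unique by blast
    then show ?thesis by (simp add: algebra_simps)
  qed
  have cont_atLeast: "continuous_on {0..} f" if "\<And>t. 0 \<le> t \<Longrightarrow> continuous_on {0..t} f" for f :: "real \<Rightarrow> 'a"
    unfolding continuous_on_eq_continuous_within
  proof
    fix t :: real assume "t \<in> {0..}"
    then have "continuous (at t within {0..t + 1}) f"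
      using that[of "t + 1"] by (auto simp: continuous_on_eq_continuous_within)
    moreover have "at t within {0..t + 1} = at t within {0..}"
      by (rule at_within_nhd[of t "{..<t + 1}"]) auto
    ultimately show "continuous (at t within {0..}) f" by simp
  qed
  have cont_v: "continuous_on {0..} v"
    unfolding v_def by (intro cont_atLeast indefinite_integral_continuous_1 Fu_int)
  \<comment> \<open>The convergence to \<open>u\<close> is only pointwise, so continuity is drawn
    from the integral formula.\<close>
  have cont_u: "continuous_on {0..} u"
  proof (rule continuous_on_eq)
    show "continuous_on {0..} (\<lambda>t. u 0 + integral {0..t} v)"
      by (intro continuous_on_add continuous_on_const cont_atLeast indefinite_integral_continuous_1 v_int)
  qed (rule u_eq[symmetric], simp)
  have cont_Fu: "continuous_on {0..} (\<lambda>t. F (u t))"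
    using u_nz by (intro continuous_on_compose2[OF cont_F cont_u]) auto
  have l': "norm (fst l) = 1" "m \<le> snd l" using l by auto
  have l_lim: "(\<lambda>n. \<Theta> (d n)) \<longlonglongrightarrow> fst l" "(\<lambda>n. r (d n)) \<longlonglongrightarrow> snd l"
    using tendsto_fst[OF dl] tendsto_snd[OF dl] by simp_all
  show ?thesis
  proof (rule that)
    show "norm (fst l) = 1" "0 < snd l" "0 < c" using l' m c by auto
    show "u 0 = R (fst l) *\<^sub>R fst l"
    proof (rule LIMSEQ_unique[OF x_lim])
      have "(\<lambda>n. R (\<Theta> (d n))) \<longlonglongrightarrow> R (fst l)"
        by (rule continuous_on_tendsto_compose[OF R(1) l_lim(1)]) (use l' \<Theta> in auto)
      then show "(\<lambda>n. x (d n)) \<longlonglongrightarrow> R (fst l) *\<^sub>R fst l"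
        unfolding x_def by (intro tendsto_scaleR l_lim)
    qed
    show "v 0 = 0" by (simp add: v_def)
    fix t :: real assume t: "0 \<le> t"
    have "((\<lambda>t. u 0 + integral {0..t} v) has_vector_derivative v t) (at t within {0..})"
      using has_vector_derivative_add[OF has_vector_derivative_const integral_has_vector_derivative_atLeast[OF cont_v t]] by simp
    then show "(u has_vector_derivative v t) (at t within {0..})"
      by (rule has_vector_derivative_transform[rotated 2]) (use t in \<open>auto intro: u_eq\<close>)
    show "(v has_vector_derivative F (u t)) (at t within {0..})"
      unfolding v_def by (rule integral_has_vector_derivative_atLeast[OF cont_Fu t])
    show "c * (1 + t) \<le> norm (u t)" by (rule u_lin[OF t])
    show "norm (v t - snd l *\<^sub>R e) \<le> C / (1 + t)"
    proof (rule tendsto_le[OF sequentially_bot])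
      show "(\<lambda>n. C / (1 + (t - h (d n)))) \<longlonglongrightarrow> C / (1 + t)"
        using t by (auto intro!: tendsto_eq_intros hd)
      show "(\<lambda>n. norm (w (d n) (k (d n) t) - r (d n) *\<^sub>R e)) \<longlonglongrightarrow> norm (v t - snd l *\<^sub>R e)"
        by (intro tendsto_intros v t l_lim)
      \<comment> \<open>For \<open>n\<close> at least \<open>t\<close>, time \<open>t\<close>
        precedes the final time of the scheme and the tail estimate applies. For \<open>n\<close> at
        least 1 the step is below 1, which keeps the denominators positive.\<close>
      have "norm (w (d n) (k (d n) t) - r (d n) *\<^sub>R e) \<le> C / (1 + (t - h (d n)))"
        if n: "max 1 (nat \<lceil>t\<rceil>) \<le> n" for n
      proof -
        have dn: "n \<le> d n" by (rule strict_mono_imp_increasing[OF d])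
        have tn: "t \<le> real (Suc (d n))" using n dn by linarith
        have "real (k (d n) t) \<le> t * real (Suc (d n))"
          using k(1)[OF t, of "d n"] by (simp add: h_def field_simps)
        also have "\<dots> \<le> real (Suc (d n)) * real (Suc (d n))" using tn by (intro mult_right_mono) auto
        finally have "k (d n) t \<le> Suc (Suc (d n) * Suc (d n))"
          by (metis le_SucI of_nat_le_iff of_nat_mult)
        from tail[OF this, of "d n"] have "norm (r (d n) *\<^sub>R e - w (d n) (k (d n) t)) \<le> C / (1 + real (k (d n) t) * h (d n))"
          using hit[of "d n"] by (simp add: w_def x_def)
        also have "\<dots> \<le> C / (1 + (t - h (d n)))"
        proof (rule divide_left_mono)
          have "h (d n) < 1" using n dn by (simp add: h_def)
          moreover have "0 \<le> real (k (d n) t) * h (d n)" using h(1)[of "d n"] by simp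
          ultimately show "0 < (1 + real (k (d n) t) * h (d n)) * (1 + (t - h (d n)))"
            using t by (intro mult_pos_pos) linarith+
        qed (use C k(2)[OF t, of "d n"] in auto)
        finally show ?thesis by (simp add: norm_minus_commute)
      qed
      then show "\<forall>\<^sub>F n in sequentially. norm (w (d n) (k (d n) t) - r (d n) *\<^sub>R e) \<le> C / (1 + (t - h (d n)))"
        unfolding eventually_sequentially by blast
    qed
  qed
qed

end

subsection \<open>Even continuation, asymptotic direction and energy\<close>

text \<open>The conditions at 0 match values and one-sided derivatives of both branches. For
  \<sigma> = 1 they say that \<open>f' 0\<close> vanishes, for \<sigma> = -1 that \<open>f 0\<close>
  does; starting at rest meets both needs.\<close>

lemma has_vector_derivative_parity_extension:
  fixes f :: "real \<Rightarrow> 'a::real_normed_vector"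
  assumes f: "\<And>t. 0 \<le> t \<Longrightarrow> (f has_vector_derivative f' t) (at t within {0..})"
    and 0: "\<sigma> *\<^sub>R f 0 = f 0" "- (\<sigma> *\<^sub>R f' 0) = f' 0"
  shows "((\<lambda>t. if t \<in> {0..} then f t else \<sigma> *\<^sub>R f (- t)) has_vector_derivative
     (if t \<in> {0..} then f' t else - (\<sigma> *\<^sub>R f' (- t)))) (at t)"
proof -
  have g: "((\<lambda>t. \<sigma> *\<^sub>R f (- t)) has_vector_derivative - (\<sigma> *\<^sub>R f' (- t))) (at t within {..0})"
    if "t \<le> 0" for t
  proof -
    have "(uminus has_vector_derivative - 1) (at t within {..0::real})"
      by (auto intro!: derivative_eq_intros)
    moreover have "(f has_vector_derivative f' (- t)) (at (- t) within uminus ` {..0})"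
      using f[of "- t"] that by simp
    ultimately have "((f \<circ> uminus) has_vector_derivative (- 1) *\<^sub>R f' (- t)) (at t within {..0})"
      by (rule vector_diff_chain_within)
    from has_vector_derivative_scaleR[OF DERIV_const[of \<sigma>] this] show ?thesis by (simp add: o_def)
  qed
  show ?thesis
  proof (rule has_vector_derivative_If_within_closures[where T = "{..0}"])
    have cl: "closure {0::real..} \<inter> closure {..0} = {0}" by auto
    show "t \<in> {0..} \<union> {..0}" "UNIV = {0::real..} \<union> {..0}" by auto
    show "(f has_vector_derivative f' t) (at t within {0..} \<union> closure {0..} \<inter> closure {..0})"
      if "t \<in> {0..} \<union> closure {0..} \<inter> closure {..0}"
      using f[of t] that unfolding cl by (simp add: insert_absorb)
    show "((\<lambda>t. \<sigma> *\<^sub>R f (- t)) has_vector_derivative - (\<sigma> *\<^sub>R f' (- t)))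
        (at t within {..0} \<union> closure {0..} \<inter> closure {..0})"
      if "t \<in> {..0} \<union> closure {0..} \<inter> closure {..0}"
      using g[of t] that unfolding cl by (simp add: insert_absorb)
    show "f t = \<sigma> *\<^sub>R f (- t)" "f' t = - (\<sigma> *\<^sub>R f' (- t))"
      if "t \<in> closure {0..}" "t \<in> closure {..0}"
      using that 0 by (auto simp: order_antisym_conv)
  qed
qed

text \<open>The bound on \<open>v t - w\<close> is not integrable, so
  \<open>u t - t *\<^sub>R w\<close> need not stay bounded; it suffices that it grows more slowly
  than \<open>t\<close>.\<close>

lemma average_velocity_tendsto:
  fixes u v :: "real \<Rightarrow> 'a::real_normed_vector"
  assumes u: "\<And>t. 0 \<le> t \<Longrightarrow> (u has_vector_derivative v t) (at t within {0..})"
    and v: "\<And>t. 0 \<le> t \<Longrightarrow> norm (v t - w) \<le> C / (1 + t)"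
  shows "((\<lambda>t. u t /\<^sub>R t) \<longlongrightarrow> w) at_top"
proof -
  define g where "g t = u t - t *\<^sub>R w" for t
  have C: "0 \<le> C" using order_trans[OF norm_ge_zero v[of 0]] by simp
  have g_diff: "norm (g t - g s) \<le> C / (1 + s) * (t - s)" if "0 \<le> s" "s \<le> t" for s t
  proof -
    have "norm (g t - g s) \<le> C / (1 + s) * norm (t - s)"
    proof (rule differentiable_bound[of "{s..t}"])
      fix y assume y: "y \<in> {s..t}"
      have "(u has_vector_derivative v y) (at y within {s..t})"
        using u[of y] y that by (auto intro: has_vector_derivative_within_subset)
      then show "(g has_derivative (\<lambda>h. h *\<^sub>R (v y - w))) (at y within {s..t})"
        unfolding g_def has_vector_derivative_def by (auto intro!: derivative_eq_intros simp: algebra_simps)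
      have "norm (v y - w) \<le> C / (1 + y)" using v[of y] y that by simp
      also have "\<dots> \<le> C / (1 + s)" using C y that by (intro divide_left_mono) auto
      finally show "onorm (\<lambda>h. h *\<^sub>R (v y - w)) \<le> C / (1 + s)"
        by (intro onorm_le) (metis abs_ge_zero mult.commute mult_right_mono norm_scaleR real_norm_def)
    qed (use that in auto)
    then show ?thesis using that by simp
  qed
  have bound: "norm (u t /\<^sub>R t - w) \<le> norm (g 0) / t + 2 * C / sqrt t" if t: "1 \<le> t" for t
  proof -
    \<comment> \<open>Splitting the time interval at \<open>sqrt t\<close> makes each part
      contribute at most \<open>C * sqrt t\<close>.\<close>
    define s where "s = sqrt t"
    have s: "1 \<le> s" "t = s * s" using t by (auto simp: s_def)
    then have st: "s \<le> t" by simp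
    have "norm (g t) \<le> norm (g 0) + norm (g s - g 0) + norm (g t - g s)" by norm
    also have "\<dots> \<le> norm (g 0) + C * s + C / (1 + s) * (t - s)"
      using g_diff[of 0 s] g_diff[of s t] s st by simp
    also have "C / (1 + s) * (t - s) \<le> C / s * t"
      using C s st by (intro mult_mono divide_left_mono) auto
    also have "C / s * t = C * s" using s by simp
    finally have "norm (g t) \<le> norm (g 0) + 2 * C * s" by simp
    moreover have "u t /\<^sub>R t - w = g t /\<^sub>R t" using t by (simp add: g_def scaleR_diff_right)
    ultimately have "norm (u t /\<^sub>R t - w) \<le> (norm (g 0) + 2 * C * s) / t"
      using t by (simp add: divide_right_mono divide_inverse_commute)
    also have "\<dots> = norm (g 0) / t + 2 * C / s" using s by (simp add: add_divide_distrib)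
    finally show ?thesis by (simp add: s_def)
  qed
  have lim: "((\<lambda>t. a / f t) \<longlongrightarrow> 0) at_top" if "filterlim f at_top at_top" for f :: "real \<Rightarrow> real" and a
    by (rule tendsto_divide_0[OF tendsto_const filterlim_at_top_imp_at_infinity[OF that]])
  have "((\<lambda>t. norm (g 0) / t + 2 * C / sqrt t) \<longlongrightarrow> 0) at_top"
    using tendsto_add[OF lim[OF filterlim_ident] lim[OF sqrt_at_top], of "norm (g 0)" "2 * C"] by simp
  moreover have "\<forall>\<^sub>F t in at_top. norm (u t /\<^sub>R t - w) \<le> norm (g 0) / t + 2 * C / sqrt t"
    using eventually_ge_at_top[of 1] by eventually_elim (rule bound)
  ultimately have "((\<lambda>t. u t /\<^sub>R t - w) \<longlongrightarrow> 0) at_top" by (rule Lim_null_comparison[rotated])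
  then show ?thesis by (simp add: LIM_zero_iff)
qed

text \<open>By the Euler identity the derivative of
  \<open>s powr \<alpha> * V (s *\<^sub>R x)\<close> in \<open>s\<close> vanishes on the positive
  half-line.\<close>

lemma euler_homogeneous:
  fixes V :: "'a::euclidean_space \<Rightarrow> real"
  assumes diff: "\<And>x. x \<noteq> 0 \<Longrightarrow> V differentiable (at x)"
    and euler: "\<And>x. x \<noteq> 0 \<Longrightarrow> x \<bullet> grad V x = - \<alpha> * V x"
    and x: "x \<noteq> 0" and s: "0 < s"
  shows "V (s *\<^sub>R x) = s powr (- \<alpha>) * V x"
proof -
  have "((\<lambda>s. s powr \<alpha> * V (s *\<^sub>R x)) has_real_derivative 0) (at s within {0<..})" if s: "0 < s" for s
  proof -
    have "((\<lambda>s. s *\<^sub>R x) has_vector_derivative x) (at s)" by (auto intro!: derivative_eq_intros)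
    moreover have "(V has_derivative (\<lambda>h. h \<bullet> grad V (s *\<^sub>R x))) (at (s *\<^sub>R x))"
      using GDERIV_grad[OF diff[of "s *\<^sub>R x"]] s x by (simp add: gderiv_def)
    ultimately have "((V \<circ> (\<lambda>s. s *\<^sub>R x)) has_vector_derivative x \<bullet> grad V (s *\<^sub>R x)) (at s)"
      by (intro vector_derivative_diff_chain_within has_derivative_at_withinI[where s = "range _"]) 
    then have "((\<lambda>s. V (s *\<^sub>R x)) has_real_derivative x \<bullet> grad V (s *\<^sub>R x)) (at s)"
      by (simp add: o_def has_real_derivative_iff_has_vector_derivative)
    from DERIV_mult[OF has_real_derivative_powr[OF s, of \<alpha>] this]
    have "((\<lambda>s. s powr \<alpha> * V (s *\<^sub>R x)) has_real_derivative
        (\<alpha> * s powr (\<alpha> - 1) * V (s *\<^sub>R x) + x \<bullet> grad V (s *\<^sub>R x) * s powr \<alpha>)) (at s)" .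
    moreover have "s * (x \<bullet> grad V (s *\<^sub>R x)) = - \<alpha> * V (s *\<^sub>R x)"
      using euler[of "s *\<^sub>R x"] s x by simp
    then have "x \<bullet> grad V (s *\<^sub>R x) = - \<alpha> * V (s *\<^sub>R x) / s"
      using s by (simp add: field_simps)
    then have "\<alpha> * s powr (\<alpha> - 1) * V (s *\<^sub>R x) + x \<bullet> grad V (s *\<^sub>R x) * s powr \<alpha> = 0"
      using s by (simp add: powr_diff)
    ultimately show ?thesis by (simp add: has_field_derivative_at_within)
  qed
  then obtain K where K: "\<And>s. 0 < s \<Longrightarrow> s powr \<alpha> * V (s *\<^sub>R x) = K"
    using has_field_derivative_zero_constant[of "{0::real<..}" "\<lambda>s. s powr \<alpha> * V (s *\<^sub>R x)"] by auto
  from K[OF s] K[of 1] have "s powr \<alpha> * V (s *\<^sub>R x) = V x" by simp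
  then show ?thesis using s by (auto simp: powr_minus field_simps)
qed

theorem theorem1p5:
  fixes V :: "real ^ 'n \<Rightarrow> real"
  assumes "C1_on (- {0}) V"
    and "\<forall>x. x \<noteq> 0 \<longrightarrow> V (- x) = V x"
    and "\<exists>\<alpha>. 0 < \<alpha> \<and> \<alpha> < 2 \<and>
           (\<forall>x. x \<noteq> 0 \<longrightarrow> x \<bullet> grad V x = - \<alpha> * V x \<and> - \<alpha> * V x < 0)"
    and "\<exists>\<beta> M\<^sub>0 r\<^sub>0. \<beta> > 1 \<and> M\<^sub>0 > 0 \<and> r\<^sub>0 \<ge> 1 \<and>
           (\<forall>x. norm x \<ge> r\<^sub>0 \<longrightarrow> norm x powr (\<beta> + 1) * norm (grad V x) \<le> M\<^sub>0)"
  shows "\<forall>H>0. \<forall>e\<in>sphere 0 1. \<exists>u.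
           hyperbolic_orbit V H u \<and>
           ((\<lambda>t. u t /\<^sub>R norm (u t)) \<longlongrightarrow> e) at_top \<and>
           ((\<lambda>t. u t /\<^sub>R norm (u t)) \<longlongrightarrow> e) at_bot"
proof (intro allI impI ballI)
  fix H :: real and e :: "real ^ 'n"
  assume H: "0 < H" and "e \<in> sphere 0 1"
  then have e: "norm e = 1" by simp
  have diff: "V differentiable (at x)" if "x \<noteq> 0" for x
    using assms(1) that by (auto simp: C1_on_def)
  have cont_grad: "continuous_on (- {0}) (grad V)" using assms(1) by (simp add: C1_on_def)
  obtain \<alpha> where \<alpha>: "0 < \<alpha>" and euler: "\<And>x. x \<noteq> 0 \<Longrightarrow> x \<bullet> grad V x = - \<alpha> * V x"
    and neg: "\<And>x. x \<noteq> 0 \<Longrightarrow> - \<alpha> * V x < 0"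
    using assms(3) by blast
  have V_pos: "0 < V x" if "x \<noteq> 0" for x
    using neg[OF that] \<alpha> by (simp add: zero_less_mult_iff)
  obtain \<beta> M r0 where \<beta>: "\<beta> > 1" and M: "M > 0" and r0: "r0 \<ge> 1"
    and decay: "\<And>x. norm x \<ge> r0 \<Longrightarrow> norm x powr (\<beta> + 1) * norm (grad V x) \<le> M"
    using assms(4) by blast
  interpret repulsive_force "\<lambda>x. - grad V x" M r0
  proof
    show "continuous_on (- {0}) (\<lambda>x. - grad V x)" by (intro continuous_intros cont_grad)
    show "0 < - grad V x \<bullet> x" if "x \<noteq> 0" for x
      using euler[OF that] neg[OF that] by (simp add: inner_commute)
    show "norm (- grad V x) * (norm x)\<^sup>2 \<le> M" if "r0 \<le> norm x" for x
    proof -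
      \<comment> \<open>Here \<beta> > 1 and \<open>norm x \<ge> r0 \<ge> 1\<close> enter.\<close>
      have "norm x powr 2 \<le> norm x powr (\<beta> + 1)" using that r0 \<beta> by (intro powr_mono) auto
      then have "(norm x)\<^sup>2 \<le> norm x powr (\<beta> + 1)" using that r0 by (simp add: powr_numeral)
      from mult_right_mono[OF this, of "norm (grad V x)"] decay[OF that]
      show ?thesis by (simp add: mult.commute)
    qed
  qed
  \<comment> \<open>By homogeneity this is the radius at which the ray through \<theta> meets the
    level set \<open>V = H\<close>.\<close>
  define R where "R \<theta> = (V \<theta> / H) powr (1 / \<alpha>)" for \<theta>
  have R_pos: "0 < R \<theta>" if "norm \<theta> = 1" for \<theta>
  proof -
    have "\<theta> \<noteq> 0" using that by auto
    then show ?thesis using V_pos[of \<theta>] H by (simp add: R_def)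
  qed
  have "continuous_on (- {0}) V"
    using diff by (intro continuous_at_imp_continuous_on ballI differentiable_imp_continuous_within) auto
  then have cont_V: "continuous_on (sphere 0 1) V" by (rule continuous_on_subset) auto
  have "V \<theta> / H \<noteq> 0" if "\<theta> \<in> sphere 0 1" for \<theta>
  proof -
    have "\<theta> \<noteq> 0" using that by auto
    then show ?thesis using V_pos[of \<theta>] H by simp
  qed
  then have R_cont: "continuous_on (sphere 0 1) R"
    unfolding R_def using H by (intro continuous_on_powr continuous_on_divide continuous_on_const cont_V) auto
  obtain \<theta> r c C u v where \<theta>: "norm \<theta> = 1" and r: "0 < r" and c: "0 < c"
    and u0: "u 0 = R \<theta> *\<^sub>R \<theta>" and v0: "v 0 = 0"
    and u': "\<And>t. 0 \<le> t \<Longrightarrow> (u has_vector_derivative v t) (at t within {0..})"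
    and v': "\<And>t. 0 \<le> t \<Longrightarrow> (v has_vector_derivative - grad V (u t)) (at t within {0..})"
    and u_ge: "\<And>t. 0 \<le> t \<Longrightarrow> c * (1 + t) \<le> norm (u t)"
    and v_lim: "\<And>t. 0 \<le> t \<Longrightarrow> norm (v t - r *\<^sub>R e) \<le> C / (1 + t)"
    by (rule asymptotic_brake_orbit[OF R_cont _ e], erule R_pos, rule that)
  have u_nz: "u t \<noteq> 0" if "0 \<le> t" for t
    using u_ge[OF that] mult_pos_pos[OF c, of "1 + t"] that by auto
  \<comment> \<open>Energy is conserved, and at time 0 it is purely potential and equal to
    \<open>H\<close> by the choice of \<open>R\<close>.\<close>
  have energy: "1 / 2 * (norm (v t))\<^sup>2 + V (u t) = H" if t: "0 \<le> t" for t
  proof -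
    let ?E = "\<lambda>t. 1 / 2 * (v t \<bullet> v t) + V (u t)"
    have "(?E has_vector_derivative 0) (at t within {0..})" if t: "0 \<le> t" for t
    proof -
      have "(V has_derivative (\<lambda>h. h \<bullet> grad V (u t))) (at (u t))"
        using GDERIV_grad[OF diff[OF u_nz[OF t]]] by (simp add: gderiv_def)
      then have "((V \<circ> u) has_vector_derivative v t \<bullet> grad V (u t)) (at t within {0..})"
        by (rule vector_derivative_diff_chain_within[OF u'[OF t] has_derivative_at_withinI])
      moreover have "((\<lambda>t. v t \<bullet> v t) has_vector_derivative - (2 * (v t \<bullet> grad V (u t)))) (at t within {0..})"
        using v'[OF t] unfolding has_vector_derivative_def
        by (auto intro!: derivative_eq_intros simp: inner_commute)
      ultimately show ?thesis
        by (auto intro!: derivative_eq_intros simp: o_def)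
    qed
    then obtain K where K: "\<And>t. 0 \<le> t \<Longrightarrow> ?E t = K"
      using has_vector_derivative_zero_constant[of "{0::real..}" ?E] by auto
    have \<theta>_nz: "\<theta> \<noteq> 0" using \<theta> by auto
    have "V (u 0) = R \<theta> powr (- \<alpha>) * V \<theta>"
      unfolding u0 by (rule euler_homogeneous[OF diff euler]) (use \<theta>_nz \<theta> R_pos in auto)
    also have "R \<theta> powr (- \<alpha>) = H / V \<theta>"
      using \<alpha> H V_pos[OF \<theta>_nz] by (simp add: R_def powr_powr powr_minus)
    also have "H / V \<theta> * V \<theta> = H" using V_pos[OF \<theta>_nz] by simp
    finally have "?E 0 = H" by (simp add: v0)
    then show ?thesis using K[OF t] K[of 0] by (simp add: power2_norm_eq_inner)
  qed
  \<comment> \<open>The scalings by 1 keep the shape of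
    \<open>has_vector_derivative_parity_extension\<close> with \<sigma> = 1.\<close>
  define y where "y t = (if t \<in> {0..} then u t else 1 *\<^sub>R u (- t))" for t
  define z where "z t = (if t \<in> {0..} then v t else - (1 *\<^sub>R v (- t)))" for t
  have y_abs: "y t = u \<bar>t\<bar>" for t by (auto simp: y_def)
  have y': "(y has_vector_derivative z t) (at t)" for t
    unfolding y_def z_def by (rule has_vector_derivative_parity_extension) (use u' v0 in auto)
  \<comment> \<open>The velocity is continued oddly, with \<sigma> = -1; two sign changes cancel in
    its derivative, as time reversal preserves the equation.\<close>
  have z': "(z has_vector_derivative - grad V (y t)) (at t)" for t
  proof -
    have "((\<lambda>t. if t \<in> {0..} then v t else (- 1) *\<^sub>R v (- t)) has_vector_derivative
     (if t \<in> {0..} then - grad V (u t) else - ((- 1) *\<^sub>R (- grad V (u (- t)))))) (at t)"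
      by (rule has_vector_derivative_parity_extension) (use v' v0 in auto)
    moreover have "z = (\<lambda>t. if t \<in> {0..} then v t else (- 1) *\<^sub>R v (- t))"
      by (auto simp: z_def)
    ultimately show ?thesis by (simp add: y_def split: if_splits)
  qed
  have z_norm: "norm (z t) = norm (v \<bar>t\<bar>)" for t by (auto simp: z_def)
  have "solves_system V H y"
    unfolding solves_system_def
  proof (intro exI allI conjI)
    fix t
    show "(y has_vector_derivative z t) (at t)" "(z has_vector_derivative - grad V (y t)) (at t)"
      by (rule y' z')+
    show "- grad V (y t) + grad V (y t) = 0" by simp
    show "1 / 2 * (norm (z t))\<^sup>2 + V (y t) = H" using energy[of "\<bar>t\<bar>"] by (simp add: z_norm y_abs)
  qed
  moreover have "y t \<noteq> 0" for t using u_nz by (simp add: y_abs)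
  moreover have top: "filterlim (\<lambda>t. norm (y t)) at_top at_top"
  proof (rule filterlim_at_top_mono)
    show "filterlim (\<lambda>t. c * (1 + t)) at_top at_top"
      by (intro filterlim_tendsto_pos_mult_at_top[OF tendsto_const c]
          filterlim_tendsto_add_at_top[OF tendsto_const] filterlim_ident)
    show "\<forall>\<^sub>F t in at_top. c * (1 + t) \<le> norm (y t)"
      using eventually_ge_at_top[of 0] by eventually_elim (use u_ge in \<open>simp add: y_abs\<close>)
  qed
  moreover have "filterlim (\<lambda>t. norm (y t)) at_top at_bot"
    using top unfolding filterlim_at_bot_mirror by (simp add: y_abs)
  moreover have dir: "((\<lambda>t. y t /\<^sub>R norm (y t)) \<longlongrightarrow> e) at_top"
  proof -
    have "((\<lambda>t. u t /\<^sub>R t) \<longlongrightarrow> r *\<^sub>R e) at_top"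
      by (rule average_velocity_tendsto[OF u' v_lim])
    \<comment> \<open>\<open>sgn\<close> is continuous at the nonzero limit velocity and ignores the
      positive factor \<open>1 / t\<close>.\<close>
    then have "((\<lambda>t. sgn (u t /\<^sub>R t)) \<longlongrightarrow> sgn (r *\<^sub>R e)) at_top"
      using r e by (intro tendsto_sgn) auto
    moreover have "sgn (r *\<^sub>R e) = e" using r e by (simp add: sgn_scaleR sgn_div_norm)
    moreover have "\<forall>\<^sub>F t in at_top. sgn (u t /\<^sub>R t) = y t /\<^sub>R norm (y t)"
      using eventually_gt_at_top[of 0]
      by eventually_elim (simp add: y_abs sgn_scaleR sgn_div_norm)
    ultimately show ?thesis by (simp add: tendsto_cong)
  qed
  moreover have "((\<lambda>t. y t /\<^sub>R norm (y t)) \<longlongrightarrow> e) at_bot"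
    using dir unfolding filterlim_at_bot_mirror by (simp add: y_abs)
  ultimately show "\<exists>u. hyperbolic_orbit V H u \<and> ((\<lambda>t. u t /\<^sub>R norm (u t)) \<longlongrightarrow> e) at_top \<and>
      ((\<lambda>t. u t /\<^sub>R norm (u t)) \<longlongrightarrow> e) at_bot"
    unfolding hyperbolic_orbit_def by blast
qed

end
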